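(* The categories $\mathcal{T}_d$ and $\mathcal{T}_3$ (defined in the context) are isomorphic via an isomorphism that is the identity on objects; in particular, for all $m,n\in\mathbb{N}$, $\mathrm{Hom}_{\mathcal{T}_d}(m,n)$ is in bijection with $\mathrm{Hom}_{\mathcal{T}_3}(m,n)$, compatibly with composition.
   Context: A graph is $(V,E)$ with $E\subseteq V\times V$; a graph morphism $(V,E)\to(V',E')$ is $f:V\to V'$ with $(s,t)\in E\Rightarrow(f(s),f(t))\in E'$, sending edge $(s,t)$ to edge $(f(s),f(t))$. The twisted $n$-cube $T_n$ has vertex set $\{0,1\}^n$ and edges: a loop at each vertex, and for each $i\in\{0,\dots,n-1\}$ and $y\in\{0,1\}^{n-1}$ an edge from $y_0\cdots y_{i-1}\,b\,y_i\cdots y_{n-2}$ to $y_0\cdots y_{i-1}\,(1-b)\,y_i\cdots y_{n-2}$, where $b=1$ if the number of zeros among $y_0,\dots,y_{i-1}$ is odd and $b=0$ otherwise. The dimension of a loop is "trivial"; that of a non-loop edge joining vertices differing in coordinate $i$ is $i$. A graph morphism is dimension-preserving if any two edges of the domain with equal dimension are sent to edges with equal dimension. The category $\mathcal{T}_d$ has objects $\mathbb{N}$, morphisms $m\to n$ the dimension-preserving graph morphisms $T_m\to T_n$, and composition of functions. Let $I=\{0,1,\star\}$. The category $\mathcal{T}_3$ has objects $\mathbb{N}$; a morphism $m\to n$ is a function $f:\{0,\dots,n-1\}\to I$ taking the value $\star$ at most $m$ times. The identity on $n$ is the constant function $\star$. For $f:k\to m$ (a function $\{0,\dots,m-1\}\to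 I$) and $g:m\to n$ (a function $\{0,\dots,n-1\}\to I$), the composite $g\circ f:\{0,\dots,n-1\}\to I$ is defined by recursion on $i$: $(g\circ f)(i)=g(i)$ if $g(i)\in\{0,1\}$; $(g\circ f)(i)=f(i')\ \mathrm{xor}\ b_i$ if $g(i)=\star$ and $f(i')\in\{0,1\}$; $(g\circ f)(i)=\star$ if $g(i)=\star$ and $f(i')=\star$; where $i'$ is the number of occurrences of $\star$ among $g(0),\dots,g(i-1)$, and $b_i=1$ if the number of zeros among $(g\circ f)(0),\dots,(g\circ f)(i-1)$ is odd and $b_i=0$ otherwise.
   Formalization: As printed, composition in T_3 violates the identity law (id_2∘(0,0) = (0,1)), so T_3 is not a category; here b_i is instead the parity of the number of zeros among the first i entries of g∘(1,…,1), not of g∘f. *)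

theory Defs
  imports "HOL-Library.FuncSet" "Graph_Theory.Pair_Digraph"
begin

section \<open>Categories\<close>

text \<open>
  Hom-sets are not required to be disjoint, so identities, composition and the arrow part of a
  functor take the objects as explicit arguments; \<open>Cmp C k m n g f\<close> is the composite
  \<open>g \<circ> f\<close> of \<open>f : k \<rightarrow> m\<close> and \<open>g : m \<rightarrow> n\<close>.
\<close>

record ('o, 'a) cat =
  Ob :: "'o set"
  Hom :: "'o \<Rightarrow> 'o \<Rightarrow> 'a set"
  Ide :: "'o \<Rightarrow> 'a"
  Cmp :: "'o \<Rightarrow> 'o \<Rightarrow> 'o \<Rightarrow> 'a \<Rightarrow> 'a \<Rightarrow> 'a"

definition is_category :: "('o, 'a) cat \<Rightarrow> bool" where
  "is_category C \<longleftrightarrow>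
     (\<forall>n\<in>Ob C. Ide C n \<in> Hom C n n) \<and>
     (\<forall>k\<in>Ob C. \<forall>m\<in>Ob C. \<forall>n\<in>Ob C. \<forall>f\<in>Hom C k m. \<forall>g\<in>Hom C m n.
        Cmp C k m n g f \<in> Hom C k n) \<and>
     (\<forall>m\<in>Ob C. \<forall>n\<in>Ob C. \<forall>f\<in>Hom C m n.
        Cmp C m m n f (Ide C m) = f \<and> Cmp C m n n (Ide C n) f = f) \<and>
     (\<forall>j\<in>Ob C. \<forall>k\<in>Ob C. \<forall>m\<in>Ob C. \<forall>n\<in>Ob C.
        \<forall>f\<in>Hom C j k. \<forall>g\<in>Hom C k m. \<forall>h\<in>Hom C m n.
          Cmp C j m n h (Cmp C j k m g f) = Cmp C j k n (Cmp C k m n h g) f)"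

definition is_functor ::
  "('o, 'a) cat \<Rightarrow> ('p, 'b) cat \<Rightarrow> ('o \<Rightarrow> 'p) \<Rightarrow> ('o \<Rightarrow> 'o \<Rightarrow> 'a \<Rightarrow> 'b) \<Rightarrow> bool" where
  "is_functor C D F0 F \<longleftrightarrow>
     (\<forall>n\<in>Ob C. F0 n \<in> Ob D) \<and>
     (\<forall>m\<in>Ob C. \<forall>n\<in>Ob C. \<forall>f\<in>Hom C m n. F m n f \<in> Hom D (F0 m) (F0 n)) \<and>
     (\<forall>n\<in>Ob C. F n n (Ide C n) = Ide D (F0 n)) \<and>
     (\<forall>k\<in>Ob C. \<forall>m\<in>Ob C. \<forall>n\<in>Ob C. \<forall>f\<in>Hom C k m. \<forall>g\<in>Hom C m n.
        F k n (Cmp C k m n g f) = Cmp D (F0 k) (F0 m) (F0 n) (F m n g) (F k m f))"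

definition is_isomorphism ::
  "('o, 'a) cat \<Rightarrow> ('p, 'b) cat \<Rightarrow> ('o \<Rightarrow> 'p) \<Rightarrow> ('o \<Rightarrow> 'o \<Rightarrow> 'a \<Rightarrow> 'b) \<Rightarrow> bool" where
  "is_isomorphism C D F0 F \<longleftrightarrow>
     is_functor C D F0 F \<and>
     (\<exists>G0 G. is_functor D C G0 G \<and>
        (\<forall>n\<in>Ob C. G0 (F0 n) = n) \<and>
        (\<forall>n\<in>Ob D. F0 (G0 n) = n) \<and>
        (\<forall>m\<in>Ob C. \<forall>n\<in>Ob C. \<forall>f\<in>Hom C m n. G (F0 m) (F0 n) (F m n f) = f) \<and>
        (\<forall>m\<in>Ob D. \<forall>n\<in>Ob D. \<forall>f\<in>Hom D m n. F (G0 m) (G0 n) (G m n f) = f))"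


section \<open>Twisted cubes and dimension-preserving graph morphisms\<close>

text \<open>
  Morphisms are extensional functions, so that two of them are equal as soon as they agree on
  the vertices of the domain.
\<close>

definition graph_homs :: "'a pair_pre_digraph \<Rightarrow> 'b pair_pre_digraph \<Rightarrow> ('a \<Rightarrow> 'b) set" where
  "graph_homs G H =
     {f \<in> pverts G \<rightarrow>\<^sub>E pverts H. \<forall>(s, t) \<in> parcs G. (f s, f t) \<in> parcs H}"

text \<open>
  Bits are booleans with \<open>False\<close> for 0 and \<open>True\<close> for 1, and xor is \<open>\<noteq>\<close>. The elements of
  \<open>{0,1}\<^sup>n\<close> are the lists of length \<open>n\<close>, indexed from 0.
\<close>

definition cube_verts :: "nat \<Rightarrow> bool list set" where
  "cube_verts n = {v. length v = n}"

definition twisted_cube :: "nat \<Rightarrow> bool list pair_pre_digraph" where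
  "twisted_cube n =
     \<lparr> pverts = cube_verts n,
       parcs = {(v, v) | v. v \<in> cube_verts n} \<union>
         {(take i y @ [b] @ drop i y, take i y @ [\<not> b] @ drop i y) | i y b.
            i < n \<and> y \<in> cube_verts (n - 1) \<and> b = odd (count_list (take i y) False)} \<rparr>"

lemma pair_wf_digraph_twisted_cube: "pair_wf_digraph (twisted_cube n)"
  by unfold_locales (auto simp: twisted_cube_def cube_verts_def)

text \<open>The trivial dimension of a loop is \<open>None\<close>.\<close>

definition edge_dim :: "bool list \<times> bool list \<Rightarrow> nat option" where
  "edge_dim e =
     (if fst e = snd e then None
      else Some (THE i. i < length (fst e) \<and> fst e ! i \<noteq> snd e ! i))"

definition dim_preserving :: "nat \<Rightarrow> (bool list \<Rightarrow> bool list) \<Rightarrow> bool" where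
  "dim_preserving m f \<longleftrightarrow>
     (\<forall>(s, t) \<in> parcs (twisted_cube m). \<forall>(s', t') \<in> parcs (twisted_cube m).
        edge_dim (s, t) = edge_dim (s', t') \<longrightarrow> edge_dim (f s, f t) = edge_dim (f s', f t'))"

definition Td :: "(nat, bool list \<Rightarrow> bool list) cat" where
  "Td =
     \<lparr> Ob = UNIV,
       Hom = (\<lambda>m n. {f \<in> graph_homs (twisted_cube m) (twisted_cube n). dim_preserving m f}),
       Ide = (\<lambda>n. restrict (\<lambda>v. v) (cube_verts n)),
       Cmp = (\<lambda>k m n g f. compose (cube_verts k) g f) \<rparr>"


section \<open>The ternary category\<close>

text \<open>
  \<open>I = {0,1,\<star>}\<close>; a function from \<open>{0,\<dots>,n-1}\<close> to \<open>I\<close> is the list of its \<open>n\<close> values.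
\<close>

datatype tern = Fixed bool | Star

definition tern_homs :: "nat \<Rightarrow> nat \<Rightarrow> tern list set" where
  "tern_homs m n = {f. length f = n \<and> count_list f Star \<le> m}"

text \<open>
  The entry with index \<open>i\<close> of the composite \<open>g \<circ> f\<close> when the value of the bit \<open>b\<^sub>i\<close> is \<open>b\<close>;
  the index \<open>i'\<close> is \<open>count_list (take i g) Star\<close>.
\<close>

definition comp_entry :: "bool \<Rightarrow> tern list \<Rightarrow> tern list \<Rightarrow> nat \<Rightarrow> tern" where
  "comp_entry b g f i =
     (case g ! i of
        Fixed c \<Rightarrow> Fixed c
      | Star \<Rightarrow>
          (case f ! count_list (take i g) Star of
             Fixed c \<Rightarrow> Fixed (c \<noteq> b)
           | Star \<Rightarrow> Star))"

text \<open>
  \<open>parity_prefix g f i\<close> lists the first \<open>i\<close> entries of the composite in which \<open>b\<^sub>i\<close> is the parity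
  of the number of zeros among the entries of the composite with index below \<open>i\<close>.
\<close>

primrec parity_prefix :: "tern list \<Rightarrow> tern list \<Rightarrow> nat \<Rightarrow> tern list" where
  "parity_prefix g f 0 = []"
| "parity_prefix g f (Suc i) =
     parity_prefix g f i @
       [comp_entry (odd (count_list (parity_prefix g f i) (Fixed False))) g f i]"

text \<open>
  Counting these zeros for every \<open>f\<close> does not give a category with the constant functions \<open>\<star>\<close>
  as identities: composing the identity on 2 with \<open>f = (0,0)\<close> would yield \<open>(0,1)\<close>.
\<close>

definition parity_T3 :: "(nat, tern list) cat" where
  "parity_T3 =
     \<lparr> Ob = UNIV,
       Hom = tern_homs,
       Ide = (\<lambda>n. replicate n Star),
       Cmp = (\<lambda>k m n g f. parity_prefix g f (length g)) \<rparr>"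

lemma parity_T3_not_category: "\<not> is_category parity_T3"
proof
  let ?f = "[Fixed False, Fixed False]"
  assume "is_category parity_T3"
  then have "\<forall>m n. \<forall>f\<in>tern_homs m n. parity_prefix (replicate n Star) f n = f"
    by (simp add: is_category_def parity_T3_def)
  moreover have "?f \<in> tern_homs 0 2"
    by (simp add: tern_homs_def)
  ultimately have "parity_prefix (replicate 2 Star) ?f 2 = ?f"
    by blast
  then show False
    by (simp add: numeral_2_eq_2 comp_entry_def)
qed

text \<open>
  A zero at \<open>i'\<close> in the argument and a zero at \<open>i\<close> in the result both reverse the later edges.
  The bit \<open>b\<^sub>i\<close> has to be the difference of the two parities, counting zeros with index below \<open>i\<close>
  in the image under \<open>g\<close> of a vertex and zeros with index below \<open>i'\<close> in the vertex itself. This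
  difference does not depend on the vertex. At the vertex \<open>1\<dots>1\<close> the second count vanishes, so
  \<open>b\<^sub>i\<close> is the parity of the number of zeros of \<open>g \<circ> (1\<dots>1)\<close> with index below \<open>i\<close>. The list of
  ones below is at least as long as the number of entries \<open>\<star>\<close> of \<open>g\<close>; the surplus is not used.
\<close>

definition twist :: "tern list \<Rightarrow> nat \<Rightarrow> bool" where
  "twist g i =
     odd (count_list (parity_prefix g (replicate (length g) (Fixed True)) i) (Fixed False))"

definition tern_comp :: "tern list \<Rightarrow> tern list \<Rightarrow> tern list" where
  "tern_comp g f = map (\<lambda>i. comp_entry (twist g i) g f i) [0..<length g]"

definition T3 :: "(nat, tern list) cat" where
  "T3 =
     \<lparr> Ob = UNIV,
       Hom = tern_homs,
       Ide = (\<lambda>n. replicate n Star),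
       Cmp = (\<lambda>k m n g f. tern_comp g f) \<rparr>"

end

theory Submission
  imports Defs
begin

text \<open>
  A ternary word \<open>g\<close> acts on the vertices of a twisted cube: bits are copied into the stars of \<open>g\<close>,
  each negated if an odd number of fixed zeros separates its star from the previous one. So the parity of
  zeros before the \<open>i\<close>-th star differs from the parity of zeros before the \<open>i\<close>-th bit of the argument
  by a constant, so edges go to edges, and composition of words corresponds to composition of actions.

  Conversely a dimension-preserving morphism \<open>f\<close> induces a partial map \<open>D\<close> on dimensions. Comparing
  the direction of an edge of dimension \<open>i\<close> with that of its translate along dimension \<open>k\<close> shows
  \<open>k < i \<longleftrightarrow> D k \<le> D i\<close> whenever \<open>k \<noteq> i\<close> and \<open>D i\<close> is defined. Hence \<open>D\<close> is strictly increasing on an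
  initial segment and undefined beyond it, and \<open>f\<close> is the action of the word that has stars on the
  range of \<open>D\<close> and the entries of \<open>f (1\<dots>1)\<close> elsewhere.
\<close>

section \<open>Transport of a category structure along bijections of hom-sets\<close>

text \<open>The maps \<open>A\<close> are injective and respect identities and composition, so the
  laws of \<open>C\<close> pull back along them and \<open>D\<close> is assumed only to have closed
  hom-sets. With \<open>D\<close> the ternary structure, associativity of the twisted composition
  thus comes from composition of functions.\<close>

lemma isomorphism_of_hom_bijections:
  fixes A :: "'o \<Rightarrow> 'o \<Rightarrow> 'b \<Rightarrow> 'a"
  assumes C: "is_category C" and ObC: "Ob C = UNIV" and ObD: "Ob D = UNIV"
    and bij: "\<And>m n. bij_betw (A m n) (Hom D m n) (Hom C m n)"
    and ide: "\<And>n. Ide D n \<in> Hom D n n"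
    and cmp: "\<And>k m n f g. f \<in> Hom D k m \<Longrightarrow> g \<in> Hom D m n \<Longrightarrow> Cmp D k m n g f \<in> Hom D k n"
    and A_ide: "\<And>n. A n n (Ide D n) = Ide C n"
    and A_cmp: "\<And>k m n f g. f \<in> Hom D k m \<Longrightarrow> g \<in> Hom D m n \<Longrightarrow>
       A k n (Cmp D k m n g f) = Cmp C k m n (A m n g) (A k m f)"
  defines "F \<equiv> \<lambda>m n. inv_into (Hom D m n) (A m n)"
  shows "is_category D" and "is_isomorphism C D (\<lambda>n. n) F"
    and "\<And>m n. bij_betw (F m n) (Hom C m n) (Hom D m n)"
    and "\<And>k m n f g. f \<in> Hom C k m \<Longrightarrow> g \<in> Hom C m n \<Longrightarrow>
       F k n (Cmp C k m n g f) = Cmp D k m n (F m n g) (F k m f)"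
proof -
  have AH: "A m n f \<in> Hom C m n" if "f \<in> Hom D m n" for m n f
    using bij that by (rule bij_betw_apply)
  have inj: "f = g" if "f \<in> Hom D m n" "g \<in> Hom D m n" "A m n f = A m n g" for m n f g
    using bij[of m n] that by (auto simp: bij_betw_def inj_on_def)
  have FA: "F m n (A m n f) = f" if "f \<in> Hom D m n" for m n f
    unfolding F_def using bij that by (rule bij_betw_inv_into_left)
  have AF: "A m n (F m n f) = f" if "f \<in> Hom C m n" for m n f
    unfolding F_def using bij that by (rule bij_betw_inv_into_right)
  show bijF: "bij_betw (F m n) (Hom C m n) (Hom D m n)" for m n
    unfolding F_def using bij by (rule bij_betw_inv_into)
  then have FH: "F m n f \<in> Hom D m n" if "f \<in> Hom C m n" for m n f
    using that by (rule bij_betw_apply)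
  note cat = C[unfolded is_category_def ObC, simplified]
  show Fcmp: "F k n (Cmp C k m n g f) = Cmp D k m n (F m n g) (F k m f)"
    if "f \<in> Hom C k m" "g \<in> Hom C m n" for k m n f g
  proof -
    have "A k n (Cmp D k m n (F m n g) (F k m f)) = Cmp C k m n g f"
      using that by (simp add: A_cmp FH AF)
    then show ?thesis using FA[OF cmp[OF FH[OF that(1)] FH[OF that(2)]]] by simp
  qed
  show "is_category D"
    unfolding is_category_def ObD
  proof (intro conjI ballI)
    fix m n f assume f: "f \<in> Hom D m n"
    show "Cmp D m m n f (Ide D m) = f"
      by (rule inj[of _ m n]) (use f cat AH in \<open>simp_all add: cmp ide A_cmp A_ide\<close>)
    show "Cmp D m n n (Ide D n) f = f"
      by (rule inj[of _ m n]) (use f cat AH in \<open>simp_all add: cmp ide A_cmp A_ide\<close>)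
  next
    fix j k m n f g h assume *: "f \<in> Hom D j k" "g \<in> Hom D k m" "h \<in> Hom D m n"
    have "Cmp C j m n (A m n h) (Cmp C j k m (A k m g) (A j k f)) =
      Cmp C j k n (Cmp C k m n (A m n h) (A k m g)) (A j k f)"
      using cat AH[OF *(1)] AH[OF *(2)] AH[OF *(3)] by blast
    then have "A j n (Cmp D j m n h (Cmp D j k m g f)) = A j n (Cmp D j k n (Cmp D k m n h g) f)"
      by (simp add: A_cmp[OF cmp[OF *(1,2)] *(3)] A_cmp[OF *(1) cmp[OF *(2,3)]]
          A_cmp[OF *(1,2)] A_cmp[OF *(2,3)])
    then show "Cmp D j m n h (Cmp D j k m g f) = Cmp D j k n (Cmp D k m n h g) f"
      by (rule inj[rotated 2]) (use * cmp in blast)+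
  qed (use ide cmp in auto)
  have "is_functor C D (\<lambda>n. n) F"
    unfolding is_functor_def ObC ObD using FH Fcmp FA[OF ide] by (simp add: A_ide)
  moreover have "is_functor D C (\<lambda>n. n) A"
    unfolding is_functor_def ObC ObD using AH A_cmp A_ide by simp
  ultimately show "is_isomorphism C D (\<lambda>n. n) F"
    unfolding is_isomorphism_def using FA AF by blast
qed

section \<open>Twisted cubes\<close>

definition flip :: "nat \<Rightarrow> bool list \<Rightarrow> bool list" where
  "flip i v = v[i := \<not> v ! i]"

text \<open>For \<open>i < length v\<close> this is the bit at coordinate \<open>i\<close> of the
  source of an edge in direction \<open>i\<close>: deleting coordinate \<open>i\<close> from
  \<open>v\<close> leaves the first \<open>i\<close> entries unchanged.\<close>

definition zero_parity :: "nat \<Rightarrow> bool list \<Rightarrow> bool" where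
  "zero_parity i v = odd (count_list (take i v) False)"

lemma length_flip [simp]: "length (flip i v) = length v"
  by (simp add: flip_def)

lemma nth_flip: "i < length v \<Longrightarrow> flip i v ! j = (v ! j \<noteq> (i = j))"
  by (auto simp: flip_def nth_list_update)

lemma flip_flip [simp]: "flip i (flip i v) = v"
  by (cases "i < length v") (simp_all add: flip_def list_update_beyond)

lemma flip_neq [simp]: "i < length v \<Longrightarrow> flip i v \<noteq> v" "i < length v \<Longrightarrow> v \<noteq> flip i v"
  by (metis nth_flip)+

lemma flip_Cons [simp]: "flip 0 (b # v) = (\<not> b) # v" "flip (Suc i) (b # v) = b # flip i v"
  by (simp_all add: flip_def)

lemma zero_parity_0 [simp]: "zero_parity 0 v = False"
  by (simp add: zero_parity_def)

lemma zero_parity_Suc [simp]: "zero_parity (Suc i) (b # v) = (b = zero_parity i v)"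
  by (auto simp: zero_parity_def)

text \<open>A flip changes the number of zeros by exactly one, and this change is seen by the prefix
  of length \<open>i\<close> just when \<open>k < i\<close>.\<close>

lemma zero_parity_flip:
  "k < length v \<Longrightarrow> zero_parity i (flip k v) = (zero_parity i v \<noteq> (k < i))"
proof (induction v arbitrary: i k)
  case (Cons b v)
  then show ?case by (cases i; cases k) auto
qed simp

lemma zero_parity_replicate: "zero_parity i (replicate m True) = False"
  by (simp add: zero_parity_def count_list_0_iff)

text \<open>Induction on the number of zeros: every vertex other than the all-ones vertex has a zero
  whose flip has fewer zeros. The base vertex is chosen because all its zero parities
  vanish.\<close>

lemma cube_induct [consumes 1, case_names ones flip]:
  assumes "length v = m" and "P (replicate m True)"
    and "\<And>v i. length v = m \<Longrightarrow> i < m \<Longrightarrow> P v \<Longrightarrow> P (flip i v)"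
  shows "P v"
  using assms(1)
proof (induction "card {i. i < m \<and> \<not> v ! i}" arbitrary: v rule: less_induct)
  case less
  show ?case
  proof (cases "\<exists>i<m. \<not> v ! i")
    case False
    then have "v = replicate m True" using less.prems by (simp add: list_eq_iff_nth_eq)
    then show ?thesis using assms(2) by simp
  next
    case True
    then obtain i where i: "i < m" "\<not> v ! i" by blast
    have "{k. k < m \<and> \<not> flip i v ! k} = {k. k < m \<and> \<not> v ! k} - {i}"
      using i less.prems by (auto simp: nth_flip)
    then have "card {k. k < m \<and> \<not> flip i v ! k} < card {k. k < m \<and> \<not> v ! k}"
      using i by (simp only:) (rule card_Diff1_less, auto)
    then have "P (flip i v)" using less by simp
    \<comment> \<open>Flipping coordinate \<open>i\<close> a second time returns to
      \<open>v\<close>.\<close>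
    from assms(3)[OF _ i(1) this] show ?thesis using less.prems by simp
  qed
qed

section \<open>Edges of the twisted cube as flips of source vertices\<close>

lemma pverts_twisted_cube [simp]: "pverts (twisted_cube n) = cube_verts n"
  by (simp add: twisted_cube_def)

lemma parcs_twisted_cube_iff:
  "(v, w) \<in> parcs (twisted_cube n) \<longleftrightarrow>
     length v = n \<and> (w = v \<or> (\<exists>i<n. w = flip i v \<and> v ! i = zero_parity i v))"
    (is "?L \<longleftrightarrow> ?R")
proof
  assume ?L
  then consider "v = w" "length v = n"
    | i y b where "v = take i y @ [b] @ drop i y" "w = take i y @ [\<not> b] @ drop i y"
        "i < n" "length y = n - 1" "b = odd (count_list (take i y) False)"
    by (auto simp: twisted_cube_def cube_verts_def)
  then show ?R
  proof cases
    case 2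
    then have "w = flip i v" "v ! i = zero_parity i v" "length v = n"
      by (auto simp: flip_def zero_parity_def nth_append list_update_append)
    then show ?thesis using 2 by blast
  qed simp
next
  assume ?R
  then consider "w = v" "length v = n"
    | i where "length v = n" "i < n" "w = flip i v" "v ! i = zero_parity i v" by blast
  then show ?L
  proof cases
    case 2
    \<comment> \<open>The word parametrising the edge is the source with coordinate \<open>i\<close>
      deleted.\<close>
    let ?y = "take i v @ drop (Suc i) v"
    have "v = take i ?y @ [v ! i] @ drop i ?y"
      using 2(1,2) by (simp add: id_take_nth_drop[symmetric])
    moreover have "w = take i ?y @ [\<not> v ! i] @ drop i ?y"
      using 2 by (simp add: flip_def upd_conv_take_nth_drop)
    moreover have "?y \<in> cube_verts (n - 1)" using 2 by (simp add: cube_verts_def)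
    moreover have "v ! i = odd (count_list (take i ?y) False)"
      using 2 by (simp add: zero_parity_def)
    ultimately show ?thesis using \<open>i < n\<close> unfolding twisted_cube_def by auto
  qed (simp add: twisted_cube_def cube_verts_def)
qed

lemma edge_dim_refl [simp]: "edge_dim (v, v) = None"
  by (simp add: edge_dim_def)

lemma edge_dim_flip: "i < length v \<Longrightarrow> edge_dim (v, flip i v) = Some i"
  unfolding edge_dim_def by (auto simp: nth_flip)

section \<open>The category of dimension-preserving morphisms\<close>

lemma mem_Hom_Td:
  "f \<in> Hom Td m n \<longleftrightarrow> f \<in> cube_verts m \<rightarrow>\<^sub>E cube_verts n \<and>
     (\<forall>(s, t) \<in> parcs (twisted_cube m). (f s, f t) \<in> parcs (twisted_cube n)) \<and>
     dim_preserving m f"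
  by (simp add: Td_def graph_homs_def)

lemma is_category_Td: "is_category Td"
proof -
  have arcs: "s \<in> cube_verts m" "t \<in> cube_verts m" if "(s, t) \<in> parcs (twisted_cube m)" for s t m
    using that by (auto simp: parcs_twisted_cube_iff cube_verts_def)
  have ide: "restrict (\<lambda>v. v) (cube_verts n) \<in> Hom Td n n" for n
    unfolding mem_Hom_Td dim_preserving_def by (auto simp: arcs)
  have cmp: "compose (cube_verts k) g f \<in> Hom Td k n"
    if f: "f \<in> Hom Td k m" and g: "g \<in> Hom Td m n" for k m n f g
  proof -
    have fa: "(f s, f t) \<in> parcs (twisted_cube m)" if "(s, t) \<in> parcs (twisted_cube k)" for s t
      using f that by (auto simp: mem_Hom_Td)
    have ga: "(g s, g t) \<in> parcs (twisted_cube n)" if "(s, t) \<in> parcs (twisted_cube m)" for s t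
      using g that by (auto simp: mem_Hom_Td)
    show ?thesis
      unfolding mem_Hom_Td dim_preserving_def
    proof (intro conjI ballI case_prodI2 impI)
      show "compose (cube_verts k) g f \<in> cube_verts k \<rightarrow>\<^sub>E cube_verts n"
        using f g by (auto simp: mem_Hom_Td compose_def)
    next
      fix e s t assume "e \<in> parcs (twisted_cube k)" "e = (s, t)"
      then have st: "(s, t) \<in> parcs (twisted_cube k)" by simp
      show "(compose (cube_verts k) g f s, compose (cube_verts k) g f t) \<in> parcs (twisted_cube n)"
        using ga[OF fa[OF st]] arcs[OF st] by (simp add: compose_eq)
    next
      fix e e' s t s' t'
      assume "e \<in> parcs (twisted_cube k)" "e = (s, t)" "e' \<in> parcs (twisted_cube k)" "e' = (s', t')"
        and eq: "edge_dim (s, t) = edge_dim (s', t')"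
      then have st: "(s, t) \<in> parcs (twisted_cube k)" "(s', t') \<in> parcs (twisted_cube k)" by simp_all
      have "edge_dim (f s, f t) = edge_dim (f s', f t')"
        using f st eq unfolding mem_Hom_Td dim_preserving_def by blast
      then have "edge_dim (g (f s), g (f t)) = edge_dim (g (f s'), g (f t'))"
        using g fa[OF st(1)] fa[OF st(2)] unfolding mem_Hom_Td dim_preserving_def by blast
      then show "edge_dim (compose (cube_verts k) g f s, compose (cube_verts k) g f t) =
        edge_dim (compose (cube_verts k) g f s', compose (cube_verts k) g f t')"
        using arcs[OF st(1)] arcs[OF st(2)] by (simp add: compose_eq)
    qed
  qed
  have Ide: "Ide Td n = restrict (\<lambda>v. v) (cube_verts n)"
    and Cmp: "Cmp Td k m n g f = compose (cube_verts k) g f" for k m n f g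
    by (simp_all add: Td_def)
  show ?thesis
    unfolding is_category_def Ide Cmp
  proof (intro conjI ballI)
    fix m n f assume "f \<in> Hom Td m n"
    then have f: "f \<in> cube_verts m \<rightarrow>\<^sub>E cube_verts n" by (simp add: mem_Hom_Td)
    show "compose (cube_verts m) f (restrict (\<lambda>v. v) (cube_verts m)) = f"
      using f by (intro extensionalityI[of _ "cube_verts m"]) (auto simp: compose_eq PiE_iff)
    show "compose (cube_verts m) (restrict (\<lambda>v. v) (cube_verts n)) f = f"
      using f by (intro extensionalityI[of _ "cube_verts m"]) (auto simp: compose_eq PiE_iff)
  next
    fix j k m n f g h assume "f \<in> Hom Td j k" "g \<in> Hom Td k m" "h \<in> Hom Td m n"
    then have "f \<in> cube_verts j \<rightarrow> cube_verts k" by (auto simp: mem_Hom_Td)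
    then show "compose (cube_verts j) h (compose (cube_verts j) g f) =
      compose (cube_verts j) (compose (cube_verts k) h g) f"
      by (rule compose_assoc)
  qed (rule ide, rule cmp)
qed

section \<open>The action of ternary words on vertices\<close>

text \<open>
  In both functions \<open>b\<close> is the parity of the fixed zeros since the last star. The empty-list
  equations for \<open>Star\<close> are junk: the second argument always has enough entries.
\<close>

fun twisted_subst :: "bool \<Rightarrow> tern list \<Rightarrow> tern list \<Rightarrow> tern list" where
  "twisted_subst b [] f = []"
| "twisted_subst b (Fixed c # g) f = Fixed c # twisted_subst (b = c) g f"
| "twisted_subst b (Star # g) (Fixed c # f) = Fixed (c \<noteq> b) # twisted_subst False g f"
| "twisted_subst b (Star # g) (Star # f) = Star # twisted_subst False g f"
| "twisted_subst b (Star # g) [] = []"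

fun act :: "bool \<Rightarrow> tern list \<Rightarrow> bool list \<Rightarrow> bool list" where
  "act b [] v = []"
| "act b (Fixed c # g) v = c # act (b = c) g v"
| "act b (Star # g) (x # v) = (x \<noteq> b) # act False g v"
| "act b (Star # g) [] = []"

text \<open>At the all-ones argument a star contributes the negation of \<open>twist g i\<close>,
  which is a zero exactly when the parity is odd. Hence the parity is even after every star, and
  only the fixed zeros since the last star count.\<close>

lemma twist_Suc:
  assumes "i < length g"
  shows "twist g (Suc i) = (case g ! i of Fixed c \<Rightarrow> twist g i = c | Star \<Rightarrow> False)"
proof -
  \<comment> \<open>This keeps the index read by a star at \<open>i\<close> inside the list of ones
    in \<open>twist\<close>.\<close>
  have "count_list (take i g) Star \<le> i"
    using count_le_length[of "take i g" Star] assms by simp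
  then have "count_list (take i g) Star < length g" using assms by simp
  then show ?thesis
    by (cases "g ! i") (auto simp: twist_def comp_entry_def)
qed

section \<open>Twisted composition as a recursion on lists\<close>

lemma length_tern_comp [simp]: "length (tern_comp g f) = length g"
  by (simp add: tern_comp_def)

text \<open>Descending induction on \<open>i\<close>. What the recursion must remember at position
  \<open>i\<close> is the parity \<open>twist g i\<close> and the entries of \<open>f\<close> that
  no earlier star has consumed.\<close>

lemma drop_tern_comp:
  assumes "i \<le> length g" and "count_list g Star \<le> length f"
  shows "drop i (tern_comp g f) =
    twisted_subst (twist g i) (drop i g) (drop (count_list (take i g) Star) f)"
  using assms(1)
proof (induction rule: inc_induct)
  case base
  then show ?case by (simp add: tern_comp_def)
next
  case (step i)
  let ?s = "count_list (take i g) Star"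
  have "drop i (tern_comp g f) = comp_entry (twist g i) g f i # drop (Suc i) (tern_comp g f)"
    using step.hyps Cons_nth_drop_Suc[of i "tern_comp g f"] by (simp add: tern_comp_def)
  moreover have "drop i g = g ! i # drop (Suc i) g"
    using step.hyps by (simp add: Cons_nth_drop_Suc)
  moreover have "count_list (take (Suc i) g) Star = ?s + (if g ! i = Star then 1 else 0)"
    using step.hyps by (simp add: take_Suc_conv_app_nth)
  \<comment> \<open>The star at \<open>i\<close> is itself counted in \<open>g\<close>, so the bound
    on stars leaves an entry of \<open>f\<close> at index \<open>?s\<close>.\<close>
  moreover have "drop ?s f = f ! ?s # drop (Suc ?s) f" if "g ! i = Star"
  proof -
    have "count_list (take i g @ g ! i # drop (Suc i) g) Star \<le> length f"
      using assms(2) step.hyps by (simp add: id_take_nth_drop[symmetric])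
    then show ?thesis using that by (simp add: Cons_nth_drop_Suc)
  qed
  ultimately show ?case
    using step by (cases "g ! i"; cases "f ! ?s") (auto simp: twist_Suc comp_entry_def)
qed

lemma tern_comp_eq_twisted_subst:
  "count_list g Star \<le> length f \<Longrightarrow> tern_comp g f = twisted_subst False g f"
  using drop_tern_comp[of 0 g f] by (simp add: twist_def)

text \<open>A star of the result comes from a star of \<open>f\<close>, and each entry of
  \<open>f\<close> is consumed at most once.\<close>

lemma count_twisted_subst: "count_list (twisted_subst b g f) Star \<le> count_list f Star"
  by (induction b g f rule: twisted_subst.induct) auto

section \<open>Composites and identities act as composites and identities\<close>

lemma length_act [simp]: "count_list g Star \<le> length v \<Longrightarrow> length (act b g v) = length g"
  by (induction b g v rule: act.induct) auto

text \<open>The parities carried by \<open>f\<close> and by \<open>g\<close> add up to the parity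
  carried by the composite, an invariant of the recursion: a fixed zero of \<open>g\<close> changes
  \<open>b\<close>, a fixed entry of \<open>f\<close> met at a star moves the old \<open>b\<close>
  into the output and resets it, and two stars reset everything.\<close>

lemma act_twisted_subst:
  assumes "count_list g Star \<le> length f" and "count_list f Star \<le> length v"
  shows "act (a \<noteq> b) (twisted_subst b g f) v = act b g (act a f v)"
  using assms
proof (induction b g f arbitrary: a v rule: twisted_subst.induct)
  case (2 b c g f)
  have "((a \<noteq> b) = c) = (a \<noteq> (b = c))" by blast
  then show ?case using 2 by simp
next
  case (3 b g c f)
  have "((a \<noteq> b) = (c \<noteq> b)) = ((a = c) \<noteq> False)" by blast
  moreover have "act ((a = c) \<noteq> False) (twisted_subst False g f) v = act False g (act (a = c) f v)"
    by (rule "3.IH") (use "3.prems" in simp_all)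
  ultimately show ?case by simp
next
  case (4 b g f)
  then obtain x v' where v: "v = x # v'" by (cases v) auto
  have "act (False \<noteq> False) (twisted_subst False g f) v' = act False g (act False f v')"
    by (rule "4.IH") (use "4.prems" v in simp_all)
  then show ?case using v by auto
qed simp_all

lemma act_replicate_Star: "act False (replicate (length v) Star) v = v"
  by (induction v) auto

text \<open>The carried parity depends on \<open>g\<close> alone, so a changed bit of
  \<open>v\<close> affects only the output at the star reading it.\<close>

lemma act_flip:
  assumes "p < length g" "g ! p = Star" "count_list g Star \<le> length v"
  shows "act b g (flip (count_list (take p g) Star) v) = flip p (act b g v)"
  using assms
proof (induction b g v arbitrary: p rule: act.induct)
  case (2 b c g v)
  then show ?case by (cases p) auto
next
  case (3 b g x v)
  then show ?case by (cases p) auto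
qed auto

text \<open>The stars read the bits of \<open>v\<close> one by one from the left and stop before
  index \<open>i\<close>.\<close>

lemma act_flip_unused:
  assumes "count_list g Star \<le> i" "count_list g Star \<le> length v"
  shows "act b g (flip i v) = act b g v"
  using assms
proof (induction b g v arbitrary: i rule: act.induct)
  case (3 b g x v)
  then show ?case by (cases i) auto
qed auto

text \<open>A bit compared with its zero parity tells whether the vertex is a source in that
  direction, so with \<open>b\<close> false edges keep their orientation. A fixed zero changes
  \<open>b\<close> and the output parity together; a star that reads \<open>x\<close> writes
  \<open>x\<close> xor \<open>b\<close>, so the zero parities of output and input then differ by
  exactly \<open>b\<close>.\<close>

lemma act_zero_parity:
  assumes "p < length g" "g ! p = Star" "count_list g Star \<le> length v"
  defines "i \<equiv> count_list (take p g) Star"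
  shows "(act b g v ! p \<noteq> zero_parity p (act b g v)) = ((v ! i \<noteq> zero_parity i v) \<noteq> b)"
  using assms(1-3) unfolding i_def
proof (induction b g v arbitrary: p rule: act.induct)
  case (2 b c g v)
  then obtain q where "p = Suc q" by (cases p) auto
  then show ?case using 2 by auto
next
  case (3 b g x v)
  then show ?case by (cases p) auto
qed auto

text \<open>On the all-ones vertex the parity carried at a star is the zero parity of the output so
  far, offset by the initial \<open>b\<close>, and the star writes its negation. The condition on
  \<open>c\<close> at stars says just this.\<close>

lemma act_ones:
  assumes "length c = length g" and "count_list g Star \<le> m"
    and "\<And>j. j < length g \<Longrightarrow> g ! j = Fixed (c ! j) \<or> g ! j = Star \<and> c ! j = (zero_parity j c = b)"
  shows "act b g (replicate m True) = c"
  using assms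
proof (induction g arbitrary: b c m)
  case (Cons x g)
  obtain d c' where c: "c = d # c'" using Cons.prems(1) by (cases c) auto
  have head: "x = Fixed d \<or> x = Star \<and> d = (\<not> b)"
    using Cons.prems(3)[of 0] c by auto
  have tail: "g ! j = Fixed (c' ! j) \<or> g ! j = Star \<and> c' ! j = ((d = zero_parity j c') = b)"
    if "j < length g" for j
    using Cons.prems(3)[of "Suc j"] c that by auto
  show ?case
  proof (cases x)
    case (Fixed e)
    have "act (b = d) g (replicate m True) = c'"
      by (rule Cons.IH) (use Cons.prems c Fixed tail in auto)
    then show ?thesis using Fixed head c by auto
  next
    case Star
    then obtain m' where m': "m = Suc m'" using Cons.prems(2) by (cases m) auto
    have "act False g (replicate m' True) = c'"
      by (rule Cons.IH) (use Cons.prems c Star head m' tail in auto)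
    then show ?thesis using Star head c m' by auto
  qed
qed simp

lemma act_inject:
  assumes "length g = length h" "count_list g Star \<le> m" "count_list h Star \<le> m"
    and "\<And>v. length v = m \<Longrightarrow> act b g v = act b h v"
  shows "g = h"
  using assms
proof (induction g h arbitrary: b m rule: list_induct2)
  case (Cons x g y h)
  note eq = Cons.prems(3)
  show ?case
  proof (cases x; cases y)
    fix c d assume xy: "x = Fixed c" "y = Fixed d"
    with eq[of "replicate m True"] have "c = d" by simp
    moreover have "g = h"
      by (rule Cons.IH[of m "b = c"]) (use Cons.prems xy \<open>c = d\<close> in auto)
    ultimately show ?thesis using xy by simp
  next
    fix c assume xy: "x = Fixed c" "y = Star"
    then obtain m' where m': "m = Suc m'" using Cons.prems(2) by (cases m) auto
    \<comment> \<open>With first bit \<open>c = b\<close> the star writes the negation of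
      \<open>c\<close>, which separates it from the fixed entry \<open>c\<close>.\<close>
    then show ?thesis using eq[of "(c = b) # replicate m' True"] xy by auto
  next
    fix c assume xy: "x = Star" "y = Fixed c"
    then obtain m' where m': "m = Suc m'" using Cons.prems(1) by (cases m) auto
    then show ?thesis using eq[of "(c = b) # replicate m' True"] xy by auto
  next
    assume xy: "x = Star" "y = Star"
    then obtain m' where m': "m = Suc m'" using Cons.prems(1) by (cases m) auto
    have "g = h"
    proof (rule Cons.IH[of m' False])
      show "act False g v = act False h v" if "length v = m'" for v
        using eq[of "True # v"] xy m' that by auto
    qed (use Cons.prems xy m' in auto)
    then show ?thesis using xy by simp
  qed
qed simp

section \<open>Actions of words are dimension-preserving morphisms\<close>

lemma ex_nth_star:
  "i < count_list g Star \<Longrightarrow> \<exists>p<length g. g ! p = Star \<and> count_list (take p g) Star = i"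
proof (induction g arbitrary: i)
  case (Cons x g)
  show ?case
  proof (cases "x = Star \<and> i = 0")
    case False
    then have "i - (if x = Star then 1 else 0) < count_list g Star" using Cons.prems by auto
    from Cons.IH[OF this] obtain p where
      "p < length g" "g ! p = Star" "count_list (take p g) Star = i - (if x = Star then 1 else 0)"
      by blast
    then show ?thesis using False by (intro exI[of _ "Suc p"]) auto
  qed (intro exI[of _ 0], simp)
qed simp

text \<open>Either direction \<open>i\<close> collapses or it goes to one direction \<open>p\<close>
  with sources preserved. As neither the case nor \<open>p\<close> depends on \<open>v\<close>, this
  yields both the graph morphism property and preservation of dimensions.\<close>

lemma act_flip_cases:
  assumes "count_list g Star \<le> m" "i < m"
  obtains (unused) "\<And>v. length v = m \<Longrightarrow> act False g (flip i v) = act False g v"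
  | (star) p where "p < length g"
      "\<And>v. length v = m \<Longrightarrow> act False g (flip i v) = flip p (act False g v)"
      "\<And>v. length v = m \<Longrightarrow> (act False g v ! p = zero_parity p (act False g v)) =
        (v ! i = zero_parity i v)"
proof (cases "i < count_list g Star")
  case True
  then obtain p where "p < length g" "g ! p = Star" "count_list (take p g) Star = i"
    using ex_nth_star by blast
  then show ?thesis
    using act_flip[of p g _ False] act_zero_parity[of p g _ False] assms(1)
    by (intro star[of p]) auto
next
  case False
  then show ?thesis using act_flip_unused assms(1) by (intro unused) auto
qed

lemma act_mem_Hom_Td:
  assumes g: "g \<in> tern_homs m n"
  shows "restrict (act False g) (cube_verts m) \<in> Hom Td m n"
proof -
  let ?f = "restrict (act False g) (cube_verts m)"
  have gl: "length g = n" "count_list g Star \<le> m" using g by (auto simp: tern_homs_def)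
  have f: "?f v = act False g v" "length (?f v) = n" if "length v = m" for v
    using gl that by (auto simp: cube_verts_def)
  have "?f \<in> cube_verts m \<rightarrow>\<^sub>E cube_verts n"
    using gl by (auto simp: cube_verts_def)
  moreover have "(?f s, ?f t) \<in> parcs (twisted_cube n)" if st: "(s, t) \<in> parcs (twisted_cube m)" for s t
  proof -
    have s: "length s = m" using st by (simp add: parcs_twisted_cube_iff)
    consider "t = s" | i where "i < m" "t = flip i s" "s ! i = zero_parity i s"
      using st by (auto simp: parcs_twisted_cube_iff)
    then show ?thesis
    proof cases
      case 2
      show ?thesis
        by (rule act_flip_cases[OF gl(2) 2(1)]) (use 2 s f gl in \<open>auto simp: parcs_twisted_cube_iff\<close>)
    qed (use s f in \<open>simp add: parcs_twisted_cube_iff\<close>)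
  qed
  moreover have "edge_dim (?f s, ?f t) = edge_dim (?f s', ?f t')"
    if st: "(s, t) \<in> parcs (twisted_cube m)" "(s', t') \<in> parcs (twisted_cube m)"
      and eq: "edge_dim (s, t) = edge_dim (s', t')" for s t s' t'
  proof -
    have s: "length s = m" "length s' = m" using st by (auto simp: parcs_twisted_cube_iff)
    consider "t = s" "t' = s'" | i where "i < m" "t = flip i s" "t' = flip i s'"
      using st eq by (auto simp: parcs_twisted_cube_iff edge_dim_flip)
    then show ?thesis
    proof cases
      case 2
      show ?thesis
        by (rule act_flip_cases[OF gl(2) 2(1)]) (use 2 s f gl in \<open>auto simp: edge_dim_flip\<close>)
    qed simp
  qed
  ultimately show ?thesis unfolding mem_Hom_Td dim_preserving_def by blast
qed

section \<open>Every dimension-preserving morphism is the action of a word\<close>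

lemma Hom_Td_dim_map:
  assumes f: "f \<in> Hom Td m n"
  obtains D :: "nat \<Rightarrow> nat option" where
    "\<And>i v. i < m \<Longrightarrow> length v = m \<Longrightarrow> D i = None \<Longrightarrow> f (flip i v) = f v"
    "\<And>i j. i < m \<Longrightarrow> D i = Some j \<Longrightarrow> j < n"
    "\<And>i j v. i < m \<Longrightarrow> length v = m \<Longrightarrow> D i = Some j \<Longrightarrow> f (flip i v) = flip j (f v)"
    "\<And>i j v. i < m \<Longrightarrow> length v = m \<Longrightarrow> D i = Some j \<Longrightarrow>
       (f v ! j = zero_parity j (f v)) = (v ! i = zero_parity i v)"
proof -
  have fl: "length (f v) = n" if "length v = m" for v
    using f that by (auto simp: mem_Hom_Td cube_verts_def)
  have fa: "(f s, f t) \<in> parcs (twisted_cube n)" if "(s, t) \<in> parcs (twisted_cube m)" for s t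
    using f that by (auto simp: mem_Hom_Td)
  \<comment> \<open>The source of the unique edge in direction \<open>i\<close> incident with
    \<open>v\<close>.\<close>
  define src where "src i v = (if v ! i = zero_parity i v then v else flip i v)" for i v
  \<comment> \<open>Read off at the edge through the all-ones vertex; dimension preservation gives
    the same value at every other edge in direction \<open>i\<close>. The value \<open>None\<close>
    means that these edges collapse to loops.\<close>
  define D where "D i = (let s = src i (replicate m True) in edge_dim (f s, f (flip i s)))" for i
  have src: "length (src i v) = m" "(src i v, flip i (src i v)) \<in> parcs (twisted_cube m)"
    if "i < m" "length v = m" for i v
    using that by (auto simp: src_def parcs_twisted_cube_iff nth_flip zero_parity_flip)
  have dim: "edge_dim (f (src i v), f (flip i (src i v))) = D i" if "i < m" "length v = m" for i v
  proof -
    let ?s = "src i (replicate m True)"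
    have "length ?s = m" "(?s, flip i ?s) \<in> parcs (twisted_cube m)" using src that by auto
    moreover have "edge_dim (src i v, flip i (src i v)) = edge_dim (?s, flip i ?s)"
      using that src(1) by (simp add: edge_dim_flip)
    ultimately show ?thesis
      using f src(2)[OF that] unfolding mem_Hom_Td dim_preserving_def D_def Let_def by blast
  qed
  have key: "(case D i of None \<Rightarrow> f (flip i v) = f v
     | Some j \<Rightarrow> j < n \<and> f (flip i v) = flip j (f v) \<and>
         (f v ! j = zero_parity j (f v)) = (v ! i = zero_parity i v))"
    if "i < m" "length v = m" for i v
  proof -
    let ?s = "src i v"
    have arc: "(f ?s, f (flip i ?s)) \<in> parcs (twisted_cube n)" using src(2) that fa by blast
    have ls: "length (f ?s) = n" using fl src(1) that by simp
    show ?thesis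
    proof (cases "D i")
      case None
      then have "f (flip i ?s) = f ?s"
        using arc dim[OF that] ls by (auto simp: parcs_twisted_cube_iff edge_dim_flip)
      then show ?thesis using None by (auto simp: src_def split: if_splits)
    next
      case (Some j)
      then have "j < n" "f (flip i ?s) = flip j (f ?s)" "f ?s ! j = zero_parity j (f ?s)"
        using arc dim[OF that] ls by (auto simp: parcs_twisted_cube_iff edge_dim_flip)
      then show ?thesis
        \<comment> \<open>If \<open>v\<close> is the target of its edge, then \<open>f v\<close> is
          the target of the image edge, and both source conditions fail.\<close>
        using Some ls by (cases "v ! i = zero_parity i v")
          (auto simp: src_def nth_flip zero_parity_flip)
    qed
  qed
  show thesis
  proof (rule that[of D])
    show "j < n" if "i < m" "D i = Some j" for i j
      using key[of i "replicate m True"] that by simp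
  qed (use key in \<open>fastforce split: option.splits\<close>)+
qed

lemma count_list_map_upt:
  "count_list (map h [0..<n]) x = card {j. j < n \<and> h j = x}"
proof (induction n)
  case (Suc n)
  have "{j. j < Suc n \<and> h j = x} = {j. j < n \<and> h j = x} \<union> (if h n = x then {n} else {})"
    by (auto simp: less_Suc_eq)
  then show ?case using Suc by simp
qed simp

lemma Hom_Td_is_act:
  assumes f: "f \<in> Hom Td m n"
  shows "\<exists>g \<in> tern_homs m n. f = restrict (act False g) (cube_verts m)"
proof -
  obtain D where D:
    "\<And>i v. i < m \<Longrightarrow> length v = m \<Longrightarrow> D i = None \<Longrightarrow> f (flip i v) = f v"
    "\<And>i j. i < m \<Longrightarrow> D i = Some j \<Longrightarrow> j < n"
    "\<And>i j v. i < m \<Longrightarrow> length v = m \<Longrightarrow> D i = Some j \<Longrightarrow> f (flip i v) = flip j (f v)"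
    "\<And>i j v. i < m \<Longrightarrow> length v = m \<Longrightarrow> D i = Some j \<Longrightarrow>
       (f v ! j = zero_parity j (f v)) = (v ! i = zero_parity i v)"
    using Hom_Td_dim_map[OF f] by blast
  define c where "c = f (replicate m True)"
  have fl: "length (f v) = n" if "length v = m" for v
    using f that by (auto simp: mem_Hom_Td cube_verts_def)
  \<comment> \<open>Flipping \<open>k\<close> changes the source condition in direction
    \<open>i\<close> iff \<open>k < i\<close>, by the zero parity. In the image, flipping
    \<open>l\<close> changes the condition at \<open>j\<close> iff \<open>l \<le> j\<close>, where
    \<open>l = j\<close> acts through the bit itself.\<close>
  have order: "k < i \<longleftrightarrow> (\<exists>l\<le>j. D k = Some l)" if "i < m" "k < m" "k \<noteq> i" "D i = Some j" for i k j
  proof -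
    let ?v = "replicate m True"
    have l: "length (f ?v) = n" using fl by simp
    have v: "(f ?v ! j = zero_parity j (f ?v)) = (?v ! i = zero_parity i ?v)"
      using D(4)[of i ?v j] that by simp
    have kv: "(f (flip k ?v) ! j = zero_parity j (f (flip k ?v))) =
      (flip k ?v ! i = zero_parity i (flip k ?v))"
      using D(4)[of i "flip k ?v" j] that by simp
    have "(flip k ?v ! i = zero_parity i (flip k ?v)) = ((?v ! i = zero_parity i ?v) \<noteq> (k < i))"
      using that by (auto simp: nth_flip zero_parity_flip)
    moreover have "(f (flip k ?v) ! j = zero_parity j (f (flip k ?v))) =
      ((f ?v ! j = zero_parity j (f ?v)) \<noteq> (\<exists>l\<le>j. D k = Some l))"
    proof (cases "D k")
      case None
      then show ?thesis using D(1)[of k ?v] that by simp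
    next
      case (Some l)
      then have "l < n" "f (flip k ?v) = flip l (f ?v)" using D(2,3) that by auto
      then show ?thesis using Some l by (auto simp: nth_flip zero_parity_flip)
    qed
    ultimately show ?thesis using v kv by blast
  qed
  define star where "star j \<longleftrightarrow> (\<exists>i<m. D i = Some j)" for j
  define h where "h j = (if star j then Star else Fixed (c ! j))" for j
  define g where "g = map h [0..<n]"
  have starE: "\<exists>i<m. D i = Some j" if "star j" for j using that by (simp add: star_def)
  have h_star: "h j = Star \<longleftrightarrow> star j" for j by (simp add: h_def)
  \<comment> \<open>If two distinct directions had the same image, \<open>order\<close> applied both
    ways would put each below the other.\<close>
  have D_inj: "i = k" if "i < m" "k < m" "D i = Some j" "D k = Some j" for i k j
    using order[of i k j] order[of k i j] that by fastforce
  have len: "length g = n" by (simp add: g_def)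
  have stars: "count_list g Star \<le> m"
  proof -
    have "{j. j < n \<and> h j = Star} \<subseteq> (\<lambda>i. the (D i)) ` {..<m}"
      by (force simp: h_star star_def)
    then have "card {j. j < n \<and> h j = Star} \<le> card {..<m}"
      by (metis card_image_le card_mono finite_imageI finite_lessThan order_trans)
    then show ?thesis by (simp add: g_def count_list_map_upt)
  qed
  \<comment> \<open>By \<open>order\<close> the stars before \<open>j\<close> are the images of the
    directions below \<open>i\<close>, all of them defined; by injectivity there are
    \<open>i\<close> of them.\<close>
  have pos: "count_list (take j g) Star = i" if i: "i < m" "D i = Some j" for i j
  proof -
    have "j < n" using D(2) i by blast
    then have "count_list (take j g) Star = card {l. l < j \<and> star l}"
      by (simp add: g_def take_map count_list_map_upt h_star)
    also have "{l. l < j \<and> star l} = (\<lambda>k. the (D k)) ` {..<i}"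
    proof (intro equalityI subsetI)
      fix l assume "l \<in> {l. l < j \<and> star l}"
      then obtain k where k: "k < m" "D k = Some l" "l < j" by (auto simp: star_def)
      then have "k \<noteq> i" using i by auto
      then have "k < i" using order[of i k j] i k by auto
      then show "l \<in> (\<lambda>k. the (D k)) ` {..<i}" using k by force
    next
      fix l assume "l \<in> (\<lambda>k. the (D k)) ` {..<i}"
      then obtain k where k: "k < i" "l = the (D k)" by blast
      then obtain l' where "l' \<le> j" "D k = Some l'" using order[of i k j] i by auto
      moreover then have "l' \<noteq> j" using D_inj[of k i j] k i by auto
      moreover have "k < m" using k i by simp
      ultimately show "l \<in> {l. l < j \<and> star l}" using k by (auto simp: star_def)
    qed
    also have "card \<dots> = card {..<i}"
    proof (rule card_image, rule inj_onI)
      fix k k' assume *: "k \<in> {..<i}" "k' \<in> {..<i}" "the (D k) = the (D k')"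
      then obtain l l' where "D k = Some l" "D k' = Some l'"
        using order[of i k j] order[of i k' j] i by auto
      then show "k = k'" using D_inj[of k k' l] * i by auto
    qed
    finally show ?thesis by simp
  qed
  have "f v = act False g v" if "length v = m" for v
    using that
  proof (induction rule: cube_induct)
    case ones
    have "act False g (replicate m True) = c"
    proof (rule act_ones)
      fix j assume "j < length g"
      then have j: "j < n" by (simp add: len)
      show "g ! j = Fixed (c ! j) \<or> g ! j = Star \<and> c ! j = (zero_parity j c = False)"
      proof (cases "star j")
        case True
        then obtain i where "i < m" "D i = Some j" using starE by blast
        \<comment> \<open>At the all-ones vertex the bit \<open>i\<close> is one and its zero parity
          is even, so the source condition fails there and hence also in \<open>c\<close>.\<close>
        then have "c ! j = (\<not> zero_parity j c)"
          using D(4)[of i "replicate m True" j] by (auto simp: c_def zero_parity_replicate)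
        then show ?thesis using True j by (simp add: g_def h_def)
      qed (use j in \<open>simp add: g_def h_def\<close>)
    qed (use fl stars in \<open>auto simp: len c_def\<close>)
    then show ?case by (simp add: c_def)
  next
    case (flip v i)
    show ?case
    proof (cases "D i")
      case (Some j)
      then have "j < n" "star j" using D(2) flip by (auto simp: star_def)
      then have "act False g (flip i v) = flip j (act False g v)"
        using act_flip[of j g v False] pos[of i j] Some flip stars len by (simp add: g_def h_def)
      then show ?thesis using D(3)[of i v j] Some flip by simp
    next
      case None
      \<comment> \<open>Otherwise some star has index \<open>i\<close>; it is the image of a
        direction, which by \<open>pos\<close> is \<open>i\<close> itself, against
        \<open>D i = None\<close>.\<close>
      have "count_list g Star \<le> i"
      proof (rule ccontr)
        assume "\<not> ?thesis"
        then obtain p where p: "p < n" "g ! p = Star" "count_list (take p g) Star = i"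
          using ex_nth_star[of i g] len by auto
        then have "star p" by (simp add: g_def h_star)
        then show False using pos p None starE by fastforce
      qed
      then show ?thesis using act_flip_unused[of g i v False] D(1)[of i v] None flip stars by simp
    qed
  qed
  then have "f = restrict (act False g) (cube_verts m)"
    using f by (intro extensionalityI[of _ "cube_verts m"])
      (auto simp: mem_Hom_Td cube_verts_def PiE_iff)
  moreover have "g \<in> tern_homs m n" using len stars by (simp add: tern_homs_def)
  ultimately show ?thesis by blast
qed

section \<open>The bijection on hom-sets and the isomorphism\<close>

lemma bij_betw_act:
  "bij_betw (\<lambda>g. restrict (act False g) (cube_verts m)) (tern_homs m n) (Hom Td m n)"
  unfolding bij_betw_def
proof
  show "inj_on (\<lambda>g. restrict (act False g) (cube_verts m)) (tern_homs m n)"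
  proof (rule inj_onI)
    fix g h assume *: "g \<in> tern_homs m n" "h \<in> tern_homs m n"
      "restrict (act False g) (cube_verts m) = restrict (act False h) (cube_verts m)"
    have "act False g v = act False h v" if "length v = m" for v
      using fun_cong[OF *(3), of v] that by (simp add: cube_verts_def)
    then show "g = h"
      using act_inject[of g h m False] *(1,2) by (simp add: tern_homs_def)
  qed
  show "(\<lambda>g. restrict (act False g) (cube_verts m)) ` tern_homs m n = Hom Td m n"
    using act_mem_Hom_Td Hom_Td_is_act by blast
qed

theorem theorem3p18:
  shows "is_category Td \<and> is_category T3 \<and>
    (\<exists>F. is_isomorphism Td T3 (\<lambda>n. n) F \<and>
         (\<forall>m n. bij_betw (F m n) (Hom Td m n) (Hom T3 m n)) \<and>
         (\<forall>k m n. \<forall>f \<in> Hom Td k m. \<forall>g \<in> Hom Td m n.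
            F k n (Cmp Td k m n g f) = Cmp T3 k m n (F m n g) (F k m f)))"
proof -
  define A where "A m n g = restrict (act False g) (cube_verts m)" for m n :: nat and g
  have bij: "bij_betw (A m n) (Hom T3 m n) (Hom Td m n)" for m n
    using bij_betw_act by (simp add: A_def[abs_def] T3_def)
  have ide: "Ide T3 n \<in> Hom T3 n n" for n
    using count_le_length[of "replicate n Star" Star] by (simp add: T3_def tern_homs_def)
  have cmp: "Cmp T3 k m n g f \<in> Hom T3 k n" if "f \<in> Hom T3 k m" "g \<in> Hom T3 m n" for k m n f g
    using that count_twisted_subst[of False g f] tern_comp_eq_twisted_subst[of g f, symmetric]
    by (auto simp: T3_def tern_homs_def)
  have A_ide: "A n n (Ide T3 n) = Ide Td n" for n
    using act_replicate_Star
    by (auto simp: A_def T3_def Td_def cube_verts_def intro!: restrict_ext)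
  have A_cmp: "A k n (Cmp T3 k m n g f) = Cmp Td k m n (A m n g) (A k m f)"
    if "f \<in> Hom T3 k m" "g \<in> Hom T3 m n" for k m n f g
    \<comment> \<open>Both parities start even, so the composite also starts with an even
      parity.\<close>
    using that act_twisted_subst[of g f _ False False] tern_comp_eq_twisted_subst[of g f]
    by (auto simp: A_def T3_def Td_def tern_homs_def compose_def cube_verts_def intro!: restrict_ext)
  have Ob: "Ob Td = UNIV" "Ob T3 = UNIV" by (simp_all add: Td_def T3_def)
  note iso = isomorphism_of_hom_bijections[OF is_category_Td Ob bij ide cmp A_ide A_cmp]
  show ?thesis using is_category_Td iso by blast
qed

end
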